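(* Let $\mathcal{G}_{6,6}$ be the real Lie algebra with basis $x_1,\dots,x_6$ and nonzero brackets $[x_1,x_2]=x_4$, $[x_2,x_3]=x_6$, $[x_2,x_4]=x_5$. The set $\mathfrak{X}_{6,6}$ of all complex structures on $\mathcal{G}_{6,6}$ is a 10-dimensional submanifold of $\mathbb{R}^{36}$. It consists of a single $\mathrm{Aut}(\mathcal{G}_{6,6})$-orbit: every complex structure on $\mathcal{G}_{6,6}$ is equivalent to $$J=\mathrm{diag}\left(\begin{pmatrix}0&-1\\1&0\end{pmatrix},\begin{pmatrix}0&-1\\1&0\end{pmatrix},\begin{pmatrix}0&1\\-1&0\end{pmatrix}\right).$$
   Context: Brackets of basis vectors not listed (and not obtained by antisymmetry) are zero. A complex structure on a real Lie algebra $\mathfrak{g}$ is a linear map $J:\mathfrak{g}\to\mathfrak{g}$ with $J^2=-1$ and $[JX,JY]-[X,Y]-J[JX,Y]-J[X,JY]=0$ for all $X,Y\in\mathfrak{g}$. $J$ is identified with its $6\times 6$ matrix $(\xi^k_j)$ ($k$ the row index, $j$ the column index) in the basis $(x_j)$, i.e. $Jx_j=\sum_k\xi^k_j x_k$; so the set of complex structures is a subset of $\mathbb{R}^{36}$. "Submanifold" means smooth ($C^\infty$) submanifold. $\mathrm{Aut}(\mathfrak{g})$ acts on complex structures by $J\mapsto\Phi^{-1}J\Phi$, and two complex structures are equivalent if they lie in the same orbit. $\mathrm{diag}$ denotes a block-diagonal matrix. *)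

theory Defs
  imports "HOL-Analysis.Analysis"
begin

section \<open>Smooth submanifolds of Euclidean spaces\<close>

text \<open>
  \<open>Ck_on\<close> and \<open>smooth_on\<close> are meant for open \<open>U\<close> only, where the full derivative
  \<open>at x\<close> is the right one. Successive directional derivatives of the total derivative
  encode the higher derivatives; in finite dimension this is the usual \<open>C\<^sup>k\<close>.
\<close>

primrec Ck_on :: "nat \<Rightarrow> ('a::euclidean_space \<Rightarrow> 'b::euclidean_space) \<Rightarrow> 'a set \<Rightarrow> bool" where
  "Ck_on 0 f U \<longleftrightarrow> continuous_on U f"
| "Ck_on (Suc k) f U \<longleftrightarrow>
     (\<forall>x\<in>U. f differentiable (at x)) \<and> (\<forall>v. Ck_on k (\<lambda>x. frechet_derivative f (at x) v) U)"

definition smooth_on :: "('a::euclidean_space \<Rightarrow> 'b::euclidean_space) \<Rightarrow> 'a set \<Rightarrow> bool" where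
  "smooth_on f U \<longleftrightarrow> (\<forall>k. Ck_on k f U)"

definition smooth_diffeomorphism ::
  "'a::euclidean_space set \<Rightarrow> 'b::euclidean_space set \<Rightarrow> ('a \<Rightarrow> 'b) \<Rightarrow> ('b \<Rightarrow> 'a) \<Rightarrow> bool" where
  "smooth_diffeomorphism U V f g \<longleftrightarrow>
     open U \<and> open V \<and> f ` U = V \<and> g ` V = U \<and>
     (\<forall>x\<in>U. g (f x) = x) \<and> (\<forall>y\<in>V. f (g y) = y) \<and>
     smooth_on f U \<and> smooth_on g V"

text \<open>
  Slice charts: near each of its points, \<open>S\<close> is carried by an ambient diffeomorphism to an
  open piece of a linear subspace of dimension \<open>d\<close> (any such subspace can be moved to the
  span of the first \<open>d\<close> coordinate vectors by a linear isomorphism).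
\<close>

definition smooth_submanifold :: "nat \<Rightarrow> 'a::euclidean_space set \<Rightarrow> bool" where
  "smooth_submanifold d S \<longleftrightarrow>
     (\<forall>p\<in>S. \<exists>U V f g (L :: 'a set).
        p \<in> U \<and> smooth_diffeomorphism U V f g \<and>
        subspace L \<and> dim L = d \<and> f ` (S \<inter> U) = L \<inter> V)"


section \<open>Complex structures on a Lie algebra\<close>

definition lie_bracket :: "('a::real_vector \<Rightarrow> 'a \<Rightarrow> 'a) \<Rightarrow> bool" where
  "lie_bracket br \<longleftrightarrow>
     (\<forall>X. linear (br X)) \<and> (\<forall>Y. linear (\<lambda>X. br X Y)) \<and> (\<forall>X. br X X = 0) \<and>
     (\<forall>X Y Z. br X (br Y Z) + br Y (br Z X) + br Z (br X Y) = 0)"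

definition complex_structure :: "('a::real_vector \<Rightarrow> 'a \<Rightarrow> 'a) \<Rightarrow> ('a \<Rightarrow> 'a) \<Rightarrow> bool" where
  "complex_structure br J \<longleftrightarrow>
     linear J \<and> (\<forall>X. J (J X) = - X) \<and>
     (\<forall>X Y. br (J X) (J Y) - br X Y - J (br (J X) Y) - J (br X (J Y)) = 0)"

definition lie_automorphism :: "('a::real_vector \<Rightarrow> 'a \<Rightarrow> 'a) \<Rightarrow> ('a \<Rightarrow> 'a) \<Rightarrow> bool" where
  "lie_automorphism br \<Phi> \<longleftrightarrow>
     linear \<Phi> \<and> bij \<Phi> \<and> (\<forall>X Y. \<Phi> (br X Y) = br (\<Phi> X) (\<Phi> Y))"

text \<open>
  Linear maps of \<open>\<real>\<^sup>n\<close> are represented by their matrices in the standard basis: column \<open>j\<close>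
  of \<open>M\<close> holds the coordinates of the image of the \<open>j\<close>-th basis vector.
\<close>

definition complex_structures :: "(real^'n \<Rightarrow> real^'n \<Rightarrow> real^'n) \<Rightarrow> (real^'n^'n) set" where
  "complex_structures br = {J. complex_structure br ((*v) J)}"

definition lie_aut :: "(real^'n \<Rightarrow> real^'n \<Rightarrow> real^'n) \<Rightarrow> (real^'n^'n) set" where
  "lie_aut br = {\<Phi>. lie_automorphism br ((*v) \<Phi>)}"

definition aut_orbit ::
  "(real^'n \<Rightarrow> real^'n \<Rightarrow> real^'n) \<Rightarrow> real^'n^'n \<Rightarrow> (real^'n^'n) set" where
  "aut_orbit br J = {matrix_inv \<Phi> ** J ** \<Phi> | \<Phi>. \<Phi> \<in> lie_aut br}"

definition cs_equivalent ::
  "(real^'n \<Rightarrow> real^'n \<Rightarrow> real^'n) \<Rightarrow> real^'n^'n \<Rightarrow> real^'n^'n \<Rightarrow> bool" where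
  "cs_equivalent br J K \<longleftrightarrow> aut_orbit br J = aut_orbit br K"


section \<open>The Lie algebra and its model complex structure\<close>

text \<open>In type \<open>6\<close> the indices are \<open>1, \<dots>, 6\<close>, with \<open>6 = 0\<close>. The basis vector \<open>x\<^sub>j\<close> is \<open>axis j 1\<close>.\<close>

definition G66 :: "real^6 \<Rightarrow> real^6 \<Rightarrow> real^6" where
  "G66 X Y =
     (X$1 * Y$2 - X$2 * Y$1) *\<^sub>R axis 4 1 +
     (X$2 * Y$3 - X$3 * Y$2) *\<^sub>R axis 6 1 +
     (X$2 * Y$4 - X$4 * Y$2) *\<^sub>R axis 5 1"

abbreviation X66 :: "(real^6^6) set" where
  "X66 \<equiv> complex_structures G66"

definition J66 :: "real^6^6" where
  "J66 = vector
    [vector [0, -1, 0,  0,  0, 0],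
     vector [1,  0, 0,  0,  0, 0],
     vector [0,  0, 0, -1,  0, 0],
     vector [0,  0, 1,  0,  0, 0],
     vector [0,  0, 0,  0,  0, 1],
     vector [0,  0, 0,  0, -1, 0]]"

lemma exhaust_6: "(i::6) = 1 \<or> i = 2 \<or> i = 3 \<or> i = 4 \<or> i = 5 \<or> i = 6"
proof (induct i)
  case (of_int z)
  then have "z = 0 \<or> z = 1 \<or> z = 2 \<or> z = 3 \<or> z = 4 \<or> z = 5" by simp arith
  then show ?case by auto
qed

lemma forall_6: "(\<forall>i::6. P i) \<longleftrightarrow> P 1 \<and> P 2 \<and> P 3 \<and> P 4 \<and> P 5 \<and> P 6"
  by (metis exhaust_6)

lemma UNIV_6: "(UNIV :: 6 set) = {1, 2, 3, 4, 5, 6}"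
  using exhaust_6 by auto

lemma sum_6: "sum f (UNIV :: 6 set) = f 1 + f 2 + f 3 + f 4 + f 5 + f 6"
  unfolding UNIV_6 by (simp add: ac_simps)

lemma vector_6 [simp]:
  "(vector [a, b, c, d, e, f] :: 'a::zero^6) $ 1 = a"
  "(vector [a, b, c, d, e, f] :: 'a::zero^6) $ 2 = b"
  "(vector [a, b, c, d, e, f] :: 'a::zero^6) $ 3 = c"
  "(vector [a, b, c, d, e, f] :: 'a::zero^6) $ 4 = d"
  "(vector [a, b, c, d, e, f] :: 'a::zero^6) $ 5 = e"
  "(vector [a, b, c, d, e, f] :: 'a::zero^6) $ 6 = f"
  unfolding vector_def by simp_all

lemma G66_basis:
  "G66 (axis 1 1) (axis 2 1) = axis 4 1"
  "G66 (axis 2 1) (axis 3 1) = axis 6 1"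
  "G66 (axis 2 1) (axis 4 1) = axis 5 1"
  by (simp_all add: G66_def axis_def)

lemma G66_basis_zero:
  "\<lbrakk>{i, j} \<noteq> {1, 2}; {i, j} \<noteq> {2, 3}; {i, j} \<noteq> {2, 4}\<rbrakk> \<Longrightarrow> G66 (axis i 1) (axis j 1) = 0"
proof -
  assume a: "{i, j} \<noteq> {1, 2}" "{i, j} \<noteq> {2, 3}" "{i, j} \<noteq> {2, 4}"
  have c: "axis i 1 $ k * axis j 1 $ l = (0::real)"
    if "{i, j} \<noteq> {k, l}" for k l
    using that by (auto simp: axis_def)
  show ?thesis
    unfolding G66_def c[OF a(1)] c[OF a(2)] c[OF a(3)]
      c[OF a(1)[unfolded insert_commute[of 1]]]
      c[OF a(2)[unfolded insert_commute[of 2 3]]]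
      c[OF a(3)[unfolded insert_commute[of 2 4]]]
    by simp
qed

lemma G66_nth [simp]:
  "G66 X Y $ 1 = 0" "G66 X Y $ 2 = 0" "G66 X Y $ 3 = 0"
  "G66 X Y $ 4 = X$1 * Y$2 - X$2 * Y$1"
  "G66 X Y $ 5 = X$2 * Y$4 - X$4 * Y$2"
  "G66 X Y $ 6 = X$2 * Y$3 - X$3 * Y$2"
  by (simp_all add: G66_def axis_def)

lemma lie_bracket_G66: "lie_bracket G66"
  unfolding lie_bracket_def
proof (intro conjI allI)
  show "linear (G66 X)" for X
    by (rule linearI) (simp_all add: vec_eq_iff forall_6 algebra_simps)
  show "linear (\<lambda>X. G66 X Y)" for Y
    by (rule linearI) (simp_all add: vec_eq_iff forall_6 algebra_simps)
  show "G66 X X = 0" for X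
    by (simp add: vec_eq_iff forall_6)
  show "G66 X (G66 Y Z) + G66 Y (G66 Z X) + G66 Z (G66 X Y) = 0" for X Y Z
    by (simp add: vec_eq_iff forall_6 algebra_simps)
qed

lemma J66_basis:
  "J66 *v axis 1 1 = axis 2 1" "J66 *v axis 2 1 = - axis 1 1"
  "J66 *v axis 3 1 = axis 4 1" "J66 *v axis 4 1 = - axis 3 1"
  "J66 *v axis 5 1 = - axis 6 1" "J66 *v axis 6 1 = axis 5 1"
  by (simp_all add: J66_def vec_eq_iff forall_6 matrix_vector_mult_def sum_6 axis_def)

end

(*
  With D = ad x_2 on the abelian ideal x_2 = 0, integrability of J says that D commutes with J on
  the J-invariant subspace where both X and J X have no x_2-component. Since J has no real
  eigenvectors, this forces J to preserve the flag spanned by x_5, x_6 and by x_3, ..., x_6. Then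
  J is determined by J x_1 and by the coordinates 3 to 6 of J x_4, which are free apart from two
  entries being nonzero, so the complex structures form a graph over an open set in 10
  coordinates. The automorphism sending x_1, x_2 to x_1, J x_1 carries the model to J.
*)

theory Submission
  imports Defs
begin

section \<open>Smoothness of rational maps\<close>

section \<open>Rational maps and graphs\<close>

text \<open>A class of functions closed under directional derivatives, so that smoothness costs a
  single derivative computation. The rule \<open>cong\<close> is there because derivatives are
  controlled on \<open>U\<close> only.\<close>

inductive rational_on :: "'a::euclidean_space set \<Rightarrow> ('a \<Rightarrow> real) \<Rightarrow> bool" for U where
  const: "rational_on U (\<lambda>x. c)"
| linear: "linear l \<Longrightarrow> rational_on U l"
| add: "rational_on U f \<Longrightarrow> rational_on U g \<Longrightarrow> rational_on U (\<lambda>x. f x + g x)"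
| mult: "rational_on U f \<Longrightarrow> rational_on U g \<Longrightarrow> rational_on U (\<lambda>x. f x * g x)"
| inverse: "rational_on U f \<Longrightarrow> (\<And>x. x \<in> U \<Longrightarrow> f x \<noteq> 0) \<Longrightarrow> rational_on U (\<lambda>x. inverse (f x))"
| cong: "rational_on U f \<Longrightarrow> (\<And>x. x \<in> U \<Longrightarrow> f x = g x) \<Longrightarrow> rational_on U g"

lemma rational_on_uminus: "rational_on U f \<Longrightarrow> rational_on U (\<lambda>x. - f x)"
  using rational_on.mult[OF rational_on.const[of U "-1"]] by simp

lemma rational_on_diff:
  "rational_on U f \<Longrightarrow> rational_on U g \<Longrightarrow> rational_on U (\<lambda>x. f x - g x)"
  using rational_on.add[OF _ rational_on_uminus] by simp

lemma rational_on_divide: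
  "rational_on U f \<Longrightarrow> rational_on U g \<Longrightarrow> (\<And>x. x \<in> U \<Longrightarrow> g x \<noteq> 0)
    \<Longrightarrow> rational_on U (\<lambda>x. f x / g x)"
  unfolding divide_inverse by (intro rational_on.mult rational_on.inverse)

lemma rational_on_has_derivative:
  assumes "rational_on U f" "open U"
  shows "\<exists>f'. (\<forall>x\<in>U. (f has_derivative f' x) (at x)) \<and> (\<forall>v. rational_on U (\<lambda>x. f' x v))"
  using assms(1)
proof induction
  case (const c)
  then show ?case
    by (intro exI[of _ "\<lambda>x v. 0"]) (auto intro: rational_on.const)
next
  case (linear l)
  then show ?case
    by (intro exI[of _ "\<lambda>x. l"])
       (auto intro: rational_on.const linear_imp_has_derivative)
next
  case (add f g)
  then obtain f' g' where
    "\<forall>x\<in>U. (f has_derivative f' x) (at x)" "\<forall>v. rational_on U (\<lambda>x. f' x v)"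
    "\<forall>x\<in>U. (g has_derivative g' x) (at x)" "\<forall>v. rational_on U (\<lambda>x. g' x v)"
    by blast
  then show ?case
    by (intro exI[of _ "\<lambda>x v. f' x v + g' x v"])
       (auto intro: rational_on.add has_derivative_add)
next
  case (mult f g)
  then obtain f' g' where
    "\<forall>x\<in>U. (f has_derivative f' x) (at x)" "\<forall>v. rational_on U (\<lambda>x. f' x v)"
    "\<forall>x\<in>U. (g has_derivative g' x) (at x)" "\<forall>v. rational_on U (\<lambda>x. g' x v)"
    by blast
  with mult.hyps show ?case
    by (intro exI[of _ "\<lambda>x v. f x * g' x v + f' x v * g x"])
       (auto intro!: rational_on.add rational_on.mult has_derivative_mult)
next
  case (inverse f)
  then obtain f' where
    f': "\<forall>x\<in>U. (f has_derivative f' x) (at x)" "\<forall>v. rational_on U (\<lambda>x. f' x v)"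
    by blast
  have "rational_on U (\<lambda>x. inverse (f x))"
    using inverse.hyps by (rule rational_on.inverse)
  with f' inverse.hyps show ?case
    by (intro exI[of _ "\<lambda>x v. - (inverse (f x) * f' x v * inverse (f x))"])
       (auto intro!: rational_on_uminus rational_on.mult has_derivative_inverse)
next
  case (cong f g)
  then obtain f' where
    "\<forall>x\<in>U. (f has_derivative f' x) (at x)" "\<forall>v. rational_on U (\<lambda>x. f' x v)"
    by blast
  \<comment> \<open>Openness of \<open>U\<close> lets the derivative pass from \<open>f\<close> to
    \<open>g\<close>, which agree on \<open>U\<close> only.\<close>
  then show ?case
    using cong.hyps(2) assms(2)
    by (intro exI[of _ f']) (auto intro: has_derivative_transform_within_open)
qed

lemma rational_imp_smooth_on:
  fixes F :: "'a::euclidean_space \<Rightarrow> 'b::euclidean_space"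
  assumes "open U" "\<And>b. b \<in> Basis \<Longrightarrow> rational_on U (\<lambda>x. F x \<bullet> b)"
  shows "smooth_on F U"
proof -
  \<comment> \<open>Quantifying over \<open>F\<close> inside the claim lets the induction hypothesis
    apply to the directional derivatives of \<open>F\<close>.\<close>
  have "Ck_on k F U"
    if "\<And>b. b \<in> Basis \<Longrightarrow> rational_on U (\<lambda>x. F x \<bullet> b)"
    for k and F :: "'a \<Rightarrow> 'b"
    using that
  proof (induction k arbitrary: F)
    case (0 F)
    have "continuous_on U (\<lambda>x. F x \<bullet> b)" if "b \<in> Basis" for b
      using rational_on_has_derivative[OF 0[OF that] assms(1)]
      by (metis continuous_at_imp_continuous_on has_derivative_continuous)
    then show ?case
      using continuous_on_componentwise[of U F] by simp
  next
    case (Suc k F)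
    have "\<exists>f'. (\<forall>x\<in>U. ((\<lambda>x. F x \<bullet> b) has_derivative f' x) (at x)) \<and>
        (\<forall>v. rational_on U (\<lambda>x. f' x v))" if "b \<in> Basis" for b
      using rational_on_has_derivative[OF Suc.prems[OF that] assms(1)] .
    then obtain f' where
      f': "\<And>b x. b \<in> Basis \<Longrightarrow> x \<in> U \<Longrightarrow> ((\<lambda>x. F x \<bullet> b) has_derivative f' b x) (at x)"
        "\<And>b v. b \<in> Basis \<Longrightarrow> rational_on U (\<lambda>x. f' b x v)"
      by metis
    have D: "(F has_derivative (\<lambda>v. \<Sum>b\<in>Basis. f' b x v *\<^sub>R b)) (at x)" if "x \<in> U" for x
      using f'(1)[OF _ that]
      by (subst has_derivative_componentwise_within) (simp add: inner_sum_left_Basis)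
    have "Ck_on k (\<lambda>x. frechet_derivative F (at x) v) U" for v
    proof (rule Suc.IH)
      fix b :: 'b assume b: "b \<in> Basis"
      show "rational_on U (\<lambda>x. frechet_derivative F (at x) v \<bullet> b)"
        using f'(2)[OF b]
      proof (rule rational_on.cong)
        fix x assume "x \<in> U"
        show "f' b x v = frechet_derivative F (at x) v \<bullet> b"
          using b by (simp add: frechet_derivative_at[OF D[OF \<open>x \<in> U\<close>], symmetric]
              inner_sum_left_Basis)
      qed
    qed
    then show ?case
      using D by (auto simp: differentiable_def)
  qed
  then show ?thesis
    using assms(2) by (simp add: smooth_on_def)
qed

section \<open>Fixed-point sets as smooth graphs\<close>

text \<open>
  The fixed points of \<open>G\<close> form a graph over the coordinates in \<open>d\<close>, which is flattened by
  \<open>x \<mapsto> x + \<pi> x - G x\<close> with \<open>\<pi>\<close> the projection onto these coordinates.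
\<close>

lemma smooth_submanifold_graph:
  fixes G :: "'a::euclidean_space \<Rightarrow> 'a"
  assumes U: "open U" and d: "d \<subseteq> Basis"
    and rat: "\<And>b. b \<in> Basis \<Longrightarrow> rational_on U (\<lambda>x. G x \<bullet> b)"
    and dep: "\<And>x y. x \<in> U \<Longrightarrow> (\<And>b. b \<in> d \<Longrightarrow> y \<bullet> b = x \<bullet> b) \<Longrightarrow> y \<in> U \<and> G y = G x"
    and proj: "\<And>x b. x \<in> U \<Longrightarrow> b \<in> d \<Longrightarrow> G x \<bullet> b = x \<bullet> b"
  shows "smooth_submanifold (card d) {x \<in> U. G x = x}"
proof -
  define p where "p x = (\<Sum>b\<in>Basis. (if b \<in> d then x \<bullet> b else 0) *\<^sub>R b)" for x :: 'a
  have p: "p x \<bullet> b = (if b \<in> d then x \<bullet> b else 0)" if "b \<in> Basis" for x b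
    using that by (simp add: p_def inner_sum_left_Basis)
  define L where "L = {x::'a. \<forall>b\<in>Basis. b \<notin> d \<longrightarrow> x \<bullet> b = 0}"
  define f where "f x = x + p x - G x" for x
  \<comment> \<open>On \<open>U\<close> this inverts \<open>f\<close>: both maps keep the
    coordinates in \<open>d\<close>, and \<open>p\<close> and \<open>G\<close> depend on these
    alone.\<close>
  define g where "g x = x + G x - p x" for x
  have pd: "p x \<bullet> b = x \<bullet> b" if "b \<in> d" for x b
    using p[of b x] that d by auto
  have pL: "p x \<in> L" for x
    by (simp add: L_def p)
  have p_cong: "p x = p y" if "\<And>b. b \<in> d \<Longrightarrow> x \<bullet> b = y \<bullet> b" for x y
    using that by (auto simp: p_def intro!: sum.cong)
  have Lp: "p x = x" if "x \<in> L" for x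
    using that by (auto intro!: euclidean_eqI[of "p x"] simp: L_def p)
  have fd: "f x \<bullet> b = x \<bullet> b" and gd: "g x \<bullet> b = x \<bullet> b" if "x \<in> U" "b \<in> d" for x b
    using proj[OF that] that(2) by (simp_all add: f_def g_def inner_simps pd)
  have fU: "f x \<in> U" "G (f x) = G x" and gU: "g x \<in> U" "G (g x) = G x" if "x \<in> U" for x
    using dep[OF that, of "f x"] dep[OF that, of "g x"] fd[OF that] gd[OF that] by auto
  have fg: "f (g x) = x" and gf: "g (f x) = x" if "x \<in> U" for x
    using p_cong[OF gd[OF that]] p_cong[OF fd[OF that]] fU[OF that] gU[OF that]
    by (simp_all add: f_def g_def)
  have lin: "rational_on U (\<lambda>x. x \<bullet> b)" for b
    by (rule rational_on.linear) (simp add: linear_iff inner_simps)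
  have rp: "rational_on U (\<lambda>x. p x \<bullet> b)" if "b \<in> Basis" for b
    using that lin[of b] by (cases "b \<in> d") (simp_all add: p rational_on.const)
  have "smooth_on f U" "smooth_on g U"
    unfolding f_def g_def inner_diff_left inner_add_left
    by (intro rational_imp_smooth_on U; unfold inner_diff_left inner_add_left;
        intro rational_on_diff rational_on.add lin rp rat; assumption)+
  then have diffeo: "smooth_diffeomorphism U U f g"
    unfolding smooth_diffeomorphism_def
    using U fU gU fg gf by (auto simp: image_iff) (metis+)
  have "f ` ({x \<in> U. G x = x} \<inter> U) = L \<inter> U"
  proof
    show "f ` ({x \<in> U. G x = x} \<inter> U) \<subseteq> L \<inter> U"
    proof clarify
      fix x assume x: "x \<in> U" "G x = x"
      then have "f x = p x"
        by (simp add: f_def)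
      then show "f x \<in> L \<inter> U"
        using fU(1)[OF x(1)] pL[of x] by simp
    qed
    show "L \<inter> U \<subseteq> f ` ({x \<in> U. G x = x} \<inter> U)"
    proof
      fix x assume x: "x \<in> L \<inter> U"
      \<comment> \<open>Here \<open>p x = x\<close>, so \<open>g x = G x\<close>, and
        \<open>G\<close> takes the same value at \<open>g x\<close> and at \<open>x\<close>.\<close>
      then have "G (g x) = g x"
        using gU[of x] Lp[of x] by (simp add: g_def)
      then show "x \<in> f ` ({x \<in> U. G x = x} \<inter> U)"
        using x fg[of x] gU[of x] by (auto intro!: image_eqI[of _ _ "g x"])
    qed
  qed
  moreover have "subspace L" "dim L = card d"
    using dim_substandard[OF d] subspace_substandard[of "\<lambda>b. b \<notin> d"] by (simp_all add: L_def)
  ultimately show ?thesis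
    unfolding smooth_submanifold_def
    by (intro ballI exI[of _ U] exI[of _ f] exI[of _ g] exI[of _ L]) (use diffeo in simp)
qed

section \<open>Automorphism orbits as equivalence classes\<close>

section \<open>Automorphism orbits\<close>

lemma lie_aut_invertible: "\<Phi> \<in> lie_aut br \<Longrightarrow> invertible \<Phi>"
  by (simp add: lie_aut_def lie_automorphism_def invertible_eq_bij)

lemma matrix_inv_mult:
  assumes "invertible A"
  shows "A ** matrix_inv A = mat 1" "matrix_inv A ** A = mat 1"
  using someI_ex[OF assms[unfolded invertible_def]] by (simp_all add: matrix_inv_def)

lemma matrix_inv_cancel:
  fixes A :: "real^'n^'n"
  assumes "invertible A"
  shows "matrix_inv A *v (A *v X) = X" "A *v (matrix_inv A *v X) = X"
  using assms by (simp_all add: matrix_vector_mul_assoc matrix_inv_mult)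

lemma lie_aut_matrix_inv:
  assumes "\<Phi> \<in> lie_aut br"
  shows "matrix_inv \<Phi> \<in> lie_aut br"
proof -
  note inv = lie_aut_invertible[OF assms]
  have "matrix_inv \<Phi> *v br X Y = br (matrix_inv \<Phi> *v X) (matrix_inv \<Phi> *v Y)" for X Y
  proof -
    have "\<Phi> *v br (matrix_inv \<Phi> *v X) (matrix_inv \<Phi> *v Y) = br X Y"
      using assms by (simp add: lie_aut_def lie_automorphism_def matrix_inv_cancel[OF inv])
    then show ?thesis
      by (metis matrix_inv_cancel(1)[OF inv])
  qed
  moreover have "invertible (matrix_inv \<Phi>)"
    using matrix_inv_mult[OF inv] by (auto simp: invertible_def)
  ultimately show ?thesis
    by (simp add: lie_aut_def lie_automorphism_def invertible_eq_bij)
qed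

lemma lie_aut_mult:
  assumes "\<Phi> \<in> lie_aut br" "\<Psi> \<in> lie_aut br"
  shows "\<Phi> ** \<Psi> \<in> lie_aut br"
  using assms invertible_mult[OF assms[THEN lie_aut_invertible]]
  by (simp add: lie_aut_def lie_automorphism_def invertible_eq_bij
      matrix_vector_mul_assoc[symmetric])

text \<open>Membership in an orbit is handled as an intertwining relation, which keeps inverses out
  of the later computations.\<close>

lemma aut_orbitI:
  assumes "\<Phi> \<in> lie_aut br" "\<Phi> ** J = K ** \<Phi>"
  shows "J \<in> aut_orbit br K"
proof -
  have "matrix_inv \<Phi> ** K ** \<Phi> = J"
    using matrix_inv_mult[OF lie_aut_invertible[OF assms(1)]]
    by (metis assms(2) matrix_mul_assoc matrix_mul_lid)
  then show ?thesis
    using assms(1) by (auto simp: aut_orbit_def)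
qed

lemma aut_orbitE:
  assumes "J \<in> aut_orbit br K"
  obtains \<Phi> where "\<Phi> \<in> lie_aut br" "\<Phi> ** J = K ** \<Phi>"
proof -
  obtain \<Phi> where \<Phi>: "\<Phi> \<in> lie_aut br" "J = matrix_inv \<Phi> ** K ** \<Phi>"
    using assms by (auto simp: aut_orbit_def)
  then have "\<Phi> ** J = K ** \<Phi>"
    using matrix_inv_mult[OF lie_aut_invertible[OF \<Phi>(1)]]
    by (metis matrix_mul_assoc matrix_mul_lid)
  with \<Phi>(1) show thesis ..
qed

lemma aut_orbit_sym:
  assumes "J \<in> aut_orbit br K"
  shows "K \<in> aut_orbit br J"
proof -
  obtain \<Phi> where \<Phi>: "\<Phi> \<in> lie_aut br" "\<Phi> ** J = K ** \<Phi>"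
    using assms by (rule aut_orbitE)
  have "matrix_inv \<Phi> ** K = J ** matrix_inv \<Phi>"
    using matrix_inv_mult[OF lie_aut_invertible[OF \<Phi>(1)]] \<Phi>(2)
    by (metis matrix_mul_assoc matrix_mul_lid matrix_mul_rid)
  then show ?thesis
    using aut_orbitI lie_aut_matrix_inv[OF \<Phi>(1)] by blast
qed

lemma aut_orbit_trans:
  assumes "J \<in> aut_orbit br K" "K \<in> aut_orbit br L"
  shows "J \<in> aut_orbit br L"
proof -
  obtain \<Phi> where \<Phi>: "\<Phi> \<in> lie_aut br" "\<Phi> ** J = K ** \<Phi>"
    using assms(1) by (rule aut_orbitE)
  obtain \<Psi> where \<Psi>: "\<Psi> \<in> lie_aut br" "\<Psi> ** K = L ** \<Psi>"
    using assms(2) by (rule aut_orbitE)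
  have "(\<Psi> ** \<Phi>) ** J = L ** (\<Psi> ** \<Phi>)"
    by (metis \<Phi>(2) \<Psi>(2) matrix_mul_assoc)
  then show ?thesis
    using aut_orbitI lie_aut_mult[OF \<Psi>(1) \<Phi>(1)] by blast
qed

lemma aut_orbit_eq: "J \<in> aut_orbit br K \<Longrightarrow> aut_orbit br J = aut_orbit br K"
  using aut_orbit_sym aut_orbit_trans by blast

text \<open>Both defining identities are checked after applying the injective \<Phi>, which turns
  \<open>J\<close> into \<open>K\<close> and respects brackets.\<close>

lemma complex_structures_aut_orbit:
  assumes "K \<in> complex_structures br" "J \<in> aut_orbit br K"
  shows "J \<in> complex_structures br"
proof -
  obtain \<Phi> where \<Phi>: "\<Phi> \<in> lie_aut br" "\<Phi> ** J = K ** \<Phi>"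
    using assms(2) by (rule aut_orbitE)
  note cancel = matrix_inv_cancel(1)[OF lie_aut_invertible[OF \<Phi>(1)]]
  have inj: "X = Y" if "\<Phi> *v X = \<Phi> *v Y" for X Y
    by (metis cancel that)
  have comm: "\<Phi> *v (J *v X) = K *v (\<Phi> *v X)" for X
    using \<Phi>(2) by (simp add: matrix_vector_mul_assoc)
  have br: "\<Phi> *v br X Y = br (\<Phi> *v X) (\<Phi> *v Y)" for X Y
    using \<Phi>(1) by (simp add: lie_aut_def lie_automorphism_def)
  have K: "K *v (K *v X) = - X"
    "br (K *v X) (K *v Y) - br X Y - K *v br (K *v X) Y - K *v br X (K *v Y) = 0" for X Y
    using assms(1) by (simp_all add: complex_structures_def complex_structure_def)
  have "J *v (J *v X) = - X" for X
    by (rule inj) (simp add: comm K linear_neg[OF matrix_vector_mul_linear])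
  moreover have "br (J *v X) (J *v Y) - br X Y - J *v br (J *v X) Y - J *v br X (J *v Y) = 0"
    for X Y
    by (rule inj) (simp add: comm K br matrix_vector_mult_diff_distrib)
  ultimately show ?thesis
    by (simp add: complex_structures_def complex_structure_def)
qed

section \<open>Consequences of integrability\<close>

section \<open>Complex structures on the algebra\<close>

text \<open>The restriction of \<open>ad x\<^sub>2\<close> to the abelian ideal \<open>x\<^sub>2 = 0\<close>, extended by \<open>x\<^sub>2 \<mapsto> 0\<close>.\<close>

definition D66 :: "real^6 \<Rightarrow> real^6" where
  "D66 Y = vector [0, 0, 0, - Y$1, Y$4, Y$3]"

lemma D66_nth [simp]:
  "D66 Y $ 1 = 0" "D66 Y $ 2 = 0" "D66 Y $ 3 = 0"
  "D66 Y $ 4 = - Y$1" "D66 Y $ 5 = Y$4" "D66 Y $ 6 = Y$3"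
  by (simp_all add: D66_def)

text \<open>The algebra is the semidirect product of the line through x_2 and an abelian ideal, so
  all brackets reduce to one operator.\<close>

lemma G66_eq_D66: "G66 X Y = X$2 *\<^sub>R D66 Y - Y$2 *\<^sub>R D66 X"
  by (simp add: vec_eq_iff forall_6)

lemma vec6_expand:
  fixes X :: "real^6"
  shows "X = X$1 *\<^sub>R axis 1 1 + X$2 *\<^sub>R axis 2 1 + X$3 *\<^sub>R axis 3 1
    + X$4 *\<^sub>R axis 4 1 + X$5 *\<^sub>R axis 5 1 + X$6 *\<^sub>R axis 6 1"
  by (simp add: vec_eq_iff forall_6 axis_def)

text \<open>Modulo \<open>Z\<close>, a nonzero \<open>a\<close> would make \<open>w\<close> an
  eigenvector of \<open>J\<close> with real eigenvalue \<open>c / a\<close>, whose square would have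
  to be -1.\<close>

lemma no_real_eigenvector:
  fixes J :: "'a::real_vector \<Rightarrow> 'a"
  assumes "linear J" "J (J w) = - w" "subspace Z" "\<And>z. z \<in> Z \<Longrightarrow> J z \<in> Z"
    and "w \<notin> Z" "a *\<^sub>R J w - c *\<^sub>R w \<in> Z"
  shows "a = 0"
proof (rule ccontr)
  assume "a \<noteq> 0"
  interpret linear J by fact
  let ?z = "a *\<^sub>R J w - c *\<^sub>R w"
  \<comment> \<open>This combination cancels the terms in \<open>J w\<close>.\<close>
  have "(-1) *\<^sub>R (a *\<^sub>R J ?z + c *\<^sub>R ?z) \<in> Z"
    using assms by (intro subspace_scale subspace_add) auto
  also have "(-1) *\<^sub>R (a *\<^sub>R J ?z + c *\<^sub>R ?z) = (a\<^sup>2 + c\<^sup>2) *\<^sub>R w"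
    by (simp add: diff scale assms(2) algebra_simps power2_eq_square)
  finally have "inverse (a\<^sup>2 + c\<^sup>2) *\<^sub>R (a\<^sup>2 + c\<^sup>2) *\<^sub>R w \<in> Z"
    by (rule subspace_scale[OF assms(3)])
  moreover have "a\<^sup>2 + c\<^sup>2 \<noteq> 0"
    using \<open>a \<noteq> 0\<close> by (simp add: sum_power2_eq_zero_iff)
  ultimately show False
    using assms(5) by simp
qed

text \<open>Otherwise the hyperplane x_2 = 0 is invariant under \<open>J\<close>, which then acts on
  the one-dimensional quotient by a real number with square -1.\<close>

lemma complex_structure_transversal:
  assumes "complex_structure G66 J"
  shows "\<exists>V. V$2 = 0 \<and> J V $ 2 = 1"
proof (rule ccontr)
  assume *: "\<not> ?thesis"
  have J: "linear J" "\<And>X. J (J X) = - X"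
    using assms by (auto simp: complex_structure_def)
  have 0: "J V $ 2 = 0" if "V$2 = 0" for V
  proof (rule ccontr)
    assume "J V $ 2 \<noteq> 0"
    then show False
      using * that
      by (auto dest!: spec[of _ "inverse (J V $ 2) *\<^sub>R V"] simp: linear_scale[OF J(1)])
  qed
  let ?y = "J (axis 2 1)"
  have "J (?y - ?y$2 *\<^sub>R axis 2 1) $ 2 = 0"
    by (rule 0) (simp add: axis_def)
  then have "?y $ 2 * ?y $ 2 = - 1"
    by (simp add: linear_diff[OF J(1)] linear_scale[OF J(1)] J(2))
  then show False
    using zero_le_square[of "?y $ 2"] by simp
qed

text \<open>Integrability is tested on \<open>Y\<close> and a transversal \<open>V\<close>: the
  terms \<open>G66 V Y\<close> and \<open>G66 V (J Y)\<close> vanish, and the other two become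
  \<open>D66 (J Y)\<close> and \<open>J (D66 Y)\<close>.\<close>

lemma complex_structure_D66_commute:
  assumes "complex_structure G66 J" "Y$2 = 0" "J Y $ 2 = 0"
  shows "D66 (J Y) = J (D66 Y)"
proof -
  obtain V where V: "V$2 = 0" "J V $ 2 = 1"
    using complex_structure_transversal[OF assms(1)] by blast
  have J: "linear J"
    and N: "G66 (J V) (J Y) - G66 V Y - J (G66 (J V) Y) - J (G66 V (J Y)) = 0"
    using assms by (auto simp: complex_structure_def)
  show ?thesis
    using N V assms(2,3) by (simp add: G66_eq_D66 linear_0[OF J])
qed

text \<open>
  \<open>J\<close> preserves \<open>span {x\<^sub>5, x\<^sub>6}\<close> and \<open>span {x\<^sub>3, \<dots>, x\<^sub>6}\<close>. In both cases the combination of the two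
  new basis vectors whose image has no \<open>x\<^sub>2\<close>-component would otherwise be a real eigenvector.
\<close>

lemma complex_structure_shape:
  assumes J: "complex_structure G66 J"
  shows "J (axis 5 1) = J (axis 4 1) $ 4 *\<^sub>R axis 5 1 + J (axis 4 1) $ 3 *\<^sub>R axis 6 1"
    and "J (axis 4 1) $ 1 = 0" "J (axis 4 1) $ 2 = 0" "J (axis 4 1) $ 3 \<noteq> 0"
    and "J (axis 1 1) $ 2 \<noteq> 0"
proof -
  have lin: "linear J" and sq: "\<And>X. J (J X) = - X"
    using J by (auto simp: complex_structure_def)
  interpret linear J by fact
  note comm = complex_structure_D66_commute[OF J]
  let ?f = "\<lambda>i. J (axis i 1) $ 2"
  have f: "J X $ 2 = X$1 * ?f 1 + X$2 * ?f 2 + X$3 * ?f 3 + X$4 * ?f 4 + X$5 * ?f 5 + X$6 * ?f 6"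
    for X
    by (subst vec6_expand[of X]) (simp only: add scale vector_add_component vector_scaleR_component
      real_scaleR_def)
  have D0: "D66 (axis 5 1) = 0" "D66 (axis 6 1) = 0"
    "D66 (axis 4 1) = axis 5 1" "D66 (axis 3 1) = axis 6 1"
    by (simp_all add: vec_eq_iff forall_6 axis_def)
  have D_eq_0: "Y$1 = 0 \<and> Y$3 = 0 \<and> Y$4 = 0" if "D66 Y = 0" for Y
    using that by (simp add: vec_eq_iff forall_6)

  \<comment> \<open>The coefficients make the x_2-component of \<open>J z\<close> vanish;
    \<open>z\<close> is 0 only if \<open>?f 5\<close> and \<open>?f 6\<close> both are.\<close>
  define z :: "real^6" where "z = ?f 6 *\<^sub>R axis 5 1 - ?f 5 *\<^sub>R axis 6 1"
  have z: "z$1 = 0" "z$2 = 0" "z$3 = 0" "z$4 = 0" "z$5 = ?f 6" "z$6 = - ?f 5"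
    by (simp_all add: z_def axis_def)
  have Jz2: "J z $ 2 = 0"
    by (subst f) (simp add: z)
  have Dz: "D66 z = 0"
    by (simp add: vec_eq_iff forall_6 z)
  have "D66 (J z) = 0"
    using comm[OF z(2) Jz2] Dz by (simp add: zero)
  then have Jz: "J z $ 1 = 0" "J z $ 3 = 0" "J z $ 4 = 0"
    using D_eq_0 by auto
  \<comment> \<open>\<open>J (J z) = - z\<close> has no x_2-component either, so \<open>J z\<close>
    satisfies the same linear equation in span {x_5, x_6} as \<open>z\<close>, which makes it
    parallel to a nonzero \<open>z\<close>.\<close>
  have det: "J z $ 5 * ?f 5 + J z $ 6 * ?f 6 = 0"
    using f[of "J z"] by (simp add: sq z Jz Jz2)
  have f56: "?f 5 = 0" "?f 6 = 0"
  proof -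
    have "z = 0"
    proof (rule ccontr)
      assume "z \<noteq> 0"
      then have eig: "a = 0" if "a *\<^sub>R J z - c *\<^sub>R z \<in> {0}" for a c
        using no_real_eigenvector[OF lin sq subspace_single_0 _ _ that] zero by blast
      have "?f 6 *\<^sub>R J z - (J z $ 5) *\<^sub>R z \<in> {0}" "?f 5 *\<^sub>R J z - (- J z $ 6) *\<^sub>R z \<in> {0}"
        using det by (simp_all add: vec_eq_iff forall_6 z Jz Jz2 algebra_simps)
      then have "?f 6 = 0" "?f 5 = 0"
        by (blast intro: eig)+
      with \<open>z \<noteq> 0\<close> show False
        by (simp add: z_def)
    qed
    then show "?f 5 = 0" "?f 6 = 0"
      using z by simp_all
  qed

  define Z where "Z = {X :: real^6. X$1 = 0 \<and> X$2 = 0 \<and> X$3 = 0 \<and> X$4 = 0}"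
  have Z: "subspace Z"
    by (simp add: subspace_def Z_def)
  have JZ: "J X \<in> Z" if "X \<in> Z" for X
  proof -
    have X2: "J X $ 2 = 0"
      using that by (subst f) (simp add: Z_def f56)
    have "D66 X = 0"
      using that by (simp add: Z_def vec_eq_iff forall_6)
    then have "D66 (J X) = 0"
      using comm[of X] that X2 by (simp add: Z_def zero)
    then show ?thesis
      using D_eq_0[of "J X"] X2 by (simp add: Z_def)
  qed

  \<comment> \<open>The same construction for x_3 and x_4, now working modulo
    \<open>Z\<close>.\<close>
  define w :: "real^6" where "w = ?f 4 *\<^sub>R axis 3 1 - ?f 3 *\<^sub>R axis 4 1"
  have w: "w$1 = 0" "w$2 = 0" "w$3 = ?f 4" "w$4 = - ?f 3" "w$5 = 0" "w$6 = 0"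
    by (simp_all add: w_def axis_def)
  have Jw2: "J w $ 2 = 0"
    by (subst f) (simp add: w)
  \<comment> \<open>\<open>D66 w\<close> lies in \<open>Z\<close>, hence so does
    \<open>D66 (J w) = J (D66 w)\<close>, whose fourth coordinate is
    \<open>- J w $ 1\<close>.\<close>
  have "J (D66 w) \<in> Z"
    by (rule JZ) (simp add: Z_def w)
  then have Jw1: "J w $ 1 = 0"
    using comm[OF w(2) Jw2] by (auto simp: Z_def dest: arg_cong[where f = "\<lambda>X. X $ 4"])
  have det': "J w $ 3 * ?f 3 + J w $ 4 * ?f 4 = 0"
    using f[of "J w"] by (simp add: sq w Jw1 Jw2 f56)
  have f34: "?f 3 = 0" "?f 4 = 0"
  proof -
    have "w \<in> Z"
    proof (rule ccontr)
      assume "w \<notin> Z"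
      have "?f 4 *\<^sub>R J w - (J w $ 3) *\<^sub>R w \<in> Z" "?f 3 *\<^sub>R J w - (- J w $ 4) *\<^sub>R w \<in> Z"
        using det' by (simp_all add: Z_def w Jw1 Jw2 algebra_simps)
      with \<open>w \<notin> Z\<close> have "?f 4 = 0" "?f 3 = 0"
        using no_real_eigenvector[OF lin sq Z JZ] by blast+
      with \<open>w \<notin> Z\<close> show False
        by (simp add: Z_def w)
    qed
    then show "?f 3 = 0" "?f 4 = 0"
      using w by (simp_all add: Z_def)
  qed

  have ax: "axis 5 1 \<in> Z"
    by (simp add: Z_def axis_def)
  \<comment> \<open>Since \<open>D66\<close> maps x_4 to x_5, commutation reads column 5 off column
    4.\<close>
  have D4: "D66 (J (axis 4 1)) = J (axis 5 1)"
    using comm[of "axis 4 1"] f34 D0 by (simp add: axis_def)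
  have J5: "J (axis 5 1) $ i = D66 (J (axis 4 1)) $ i" for i
    by (simp add: D4)
  show J5': "J (axis 5 1) = J (axis 4 1) $ 4 *\<^sub>R axis 5 1 + J (axis 4 1) $ 3 *\<^sub>R axis 6 1"
    using JZ[OF ax] by (simp add: vec_eq_iff forall_6 J5 Z_def) (simp add: axis_def)
  show "J (axis 4 1) $ 1 = 0"
    using JZ[OF ax] J5[of 4] by (simp add: Z_def)
  show "J (axis 4 1) $ 2 = 0"
    by (rule f34)
  show "J (axis 4 1) $ 3 \<noteq> 0"
  proof
    \<comment> \<open>With this entry 0, x_5 would be a real eigenvector.\<close>
    assume "J (axis 4 1) $ 3 = 0"
    then have "1 *\<^sub>R J (axis 5 1) - J (axis 4 1) $ 4 *\<^sub>R axis 5 1 \<in> {0}"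
      using J5' by simp
    then show False
      using no_real_eigenvector[OF lin sq subspace_single_0, of "axis 5 1"] zero
      by (metis axis_eq_0_iff singletonD singletonI zero_neq_one)
  qed
  show "J (axis 1 1) $ 2 \<noteq> 0"
  proof
    \<comment> \<open>Now \<open>?f\<close> would vanish at every basis vector other than x_2,
      against the existence of a transversal \<open>V\<close>.\<close>
    assume "J (axis 1 1) $ 2 = 0"
    moreover obtain V where "V$2 = 0" "J V $ 2 = 1"
      using complex_structure_transversal[OF J] by blast
    ultimately show False
      using f[of V] by (simp add: f34 f56)
  qed
qed


lemma J66_nth [simp]:
  "(J66 *v X) $ 1 = - X$2" "(J66 *v X) $ 2 = X$1" "(J66 *v X) $ 3 = - X$4"
  "(J66 *v X) $ 4 = X$3" "(J66 *v X) $ 5 = X$6" "(J66 *v X) $ 6 = - X$5"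
  by (simp_all add: J66_def matrix_vector_mult_def sum_6)

lemma J66_complex_structure: "J66 \<in> X66"
  by (simp add: complex_structures_def complex_structure_def vec_eq_iff forall_6 algebra_simps)

section \<open>Parametrisation by ten matrix entries\<close>

text \<open>
  By the shape of a complex structure, its columns 1 and 4 determine column 5, and \<open>J\<^sup>2 = -1\<close>
  applied to \<open>x\<^sub>5\<close>, \<open>x\<^sub>4\<close> and \<open>x\<^sub>1\<close> then determines columns 6, 3 and 2.
\<close>

definition graph66 :: "real^6^6 \<Rightarrow> real^6^6" where
  "graph66 M =
    (let c1 = column 1 M;
         c4 = vector [0, 0, M$3$4, M$4$4, M$5$4, M$6$4];
         c5 = vector [0, 0, 0, 0, M$4$4, M$3$4];
         c6 = (- 1 / M$3$4) *\<^sub>R (axis 5 1 + M$4$4 *\<^sub>R c5);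
         c3 = (- 1 / M$3$4) *\<^sub>R (axis 4 1 + M$4$4 *\<^sub>R c4 + M$5$4 *\<^sub>R c5 + M$6$4 *\<^sub>R c6);
         c2 = (- 1 / M$2$1) *\<^sub>R (axis 1 1 + M$1$1 *\<^sub>R c1 + M$3$1 *\<^sub>R c3 + M$4$1 *\<^sub>R c4
                + M$5$1 *\<^sub>R c5 + M$6$1 *\<^sub>R c6)
     in transpose (vector [c1, c2, c3, c4, c5, c6]))"

definition domain66 :: "(real^6^6) set" where
  "domain66 = {M. M$2$1 \<noteq> 0 \<and> M$3$4 \<noteq> 0}"

lemma matrix_eqI_columns:
  fixes A B :: "real^'n^'m"
  assumes "\<And>j. A *v axis j 1 = B *v axis j 1"
  shows "A = B"
  using assms by (simp add: matrix_vector_mult_basis column_def vec_eq_iff)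

lemma column_nth: "column j M $ i = M $ i $ j"
  by (simp add: column_def)

lemma matrix_vector_mult_6:
  fixes M :: "real^6^6"
  shows "M *v X = X$1 *\<^sub>R column 1 M + X$2 *\<^sub>R column 2 M + X$3 *\<^sub>R column 3 M
    + X$4 *\<^sub>R column 4 M + X$5 *\<^sub>R column 5 M + X$6 *\<^sub>R column 6 M"
  by (simp add: vec_eq_iff matrix_vector_mult_def sum_6 column_def algebra_simps)

text \<open>\<open>graph66\<close> solves the three quadratic equations one at a time: each is
  linear in a single new column, whose coefficient \<open>M$3$4\<close> or \<open>M$2$1\<close> is
  nonzero on \<open>domain66\<close>.\<close>

lemma graph66_eq_iff:
  assumes "M \<in> domain66"
  shows "graph66 M = M \<longleftrightarrow>
    M$1$4 = 0 \<and> M$2$4 = 0 \<and> column 5 M = M$4$4 *\<^sub>R axis 5 1 + M$3$4 *\<^sub>R axis 6 1 \<and>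
    M *v column 5 M = - axis 5 1 \<and> M *v column 4 M = - axis 4 1 \<and> M *v column 1 M = - axis 1 1"
    (is "_ \<longleftrightarrow> ?R")
proof -
  have solve: "(- 1 / a) *\<^sub>R x = y \<longleftrightarrow> a *\<^sub>R y = - x" if "a \<noteq> 0" for a :: real and x y :: "real^6"
    using that by (auto simp: vec_eq_iff field_simps)
  have isolate: "u + v = - z \<longleftrightarrow> v = - (z + u)" for u v z :: "real^6"
    by (simp only: eq_neg_iff_add_eq_0 ac_simps)
  have nz: "M$2$1 \<noteq> 0" "M$3$4 \<noteq> 0"
    using assms by (auto simp: domain66_def)
  \<comment> \<open>The columns are listed in the order in which \<open>graph66\<close> builds them,
    so that each equation can be rewritten with the earlier ones.\<close>
  have cols: "transpose (vector [c1, c2, c3, c4, c5, c6]) = M \<longleftrightarrow>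
      c1 = column 1 M \<and> c4 = column 4 M \<and> c5 = column 5 M \<and> c6 = column 6 M \<and>
      c3 = column 3 M \<and> c2 = column 2 M" for c1 c2 c3 c4 c5 c6 :: "real^6"
    by (auto simp: vec_eq_iff transpose_def column_def forall_6)
  have c4: "vector [0, 0, M$3$4, M$4$4, M$5$4, M$6$4] = column 4 M \<longleftrightarrow> M$1$4 = 0 \<and> M$2$4 = 0"
    by (auto simp: vec_eq_iff forall_6 column_def)
  have c5: "vector [0, 0, 0, 0, M$4$4, M$3$4] = M$4$4 *\<^sub>R axis 5 1 + M$3$4 *\<^sub>R (axis 6 1 :: real^6)"
    by (simp add: vec_eq_iff forall_6 axis_def)
  have M5: "M *v column 5 M = - axis 5 1 \<longleftrightarrow>
      M$3$4 *\<^sub>R column 6 M = - (axis 5 1 + M$4$4 *\<^sub>R column 5 M)"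
    if "column 5 M = M$4$4 *\<^sub>R axis 5 1 + M$3$4 *\<^sub>R axis 6 1"
  proof -
    have "M$1$5 = 0" "M$2$5 = 0" "M$3$5 = 0" "M$4$5 = 0" "M$5$5 = M$4$4" "M$6$5 = M$3$4"
      using that by (simp_all add: vec_eq_iff forall_6 column_def axis_def)
    then have "M *v column 5 M = M$4$4 *\<^sub>R column 5 M + M$3$4 *\<^sub>R column 6 M"
      by (simp add: matrix_vector_mult_6 column_nth)
    then show ?thesis
      by (simp only: isolate)
  qed
  have M4: "M *v column 4 M = - axis 4 1 \<longleftrightarrow> M$3$4 *\<^sub>R column 3 M =
      - (axis 4 1 + M$4$4 *\<^sub>R column 4 M + M$5$4 *\<^sub>R column 5 M + M$6$4 *\<^sub>R column 6 M)"
    if "M$1$4 = 0" "M$2$4 = 0"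
  proof -
    have "M *v column 4 M =
        (M$4$4 *\<^sub>R column 4 M + M$5$4 *\<^sub>R column 5 M + M$6$4 *\<^sub>R column 6 M) + M$3$4 *\<^sub>R column 3 M"
      using that by (simp add: matrix_vector_mult_6 column_nth)
    then show ?thesis
      by (simp only: isolate add.assoc)
  qed
  have M1: "M *v column 1 M = - axis 1 1 \<longleftrightarrow> M$2$1 *\<^sub>R column 2 M =
      - (axis 1 1 + M$1$1 *\<^sub>R column 1 M + M$3$1 *\<^sub>R column 3 M + M$4$1 *\<^sub>R column 4 M
          + M$5$1 *\<^sub>R column 5 M + M$6$1 *\<^sub>R column 6 M)"
  proof -
    have "M *v column 1 M = (M$1$1 *\<^sub>R column 1 M + M$3$1 *\<^sub>R column 3 M + M$4$1 *\<^sub>R column 4 M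
        + M$5$1 *\<^sub>R column 5 M + M$6$1 *\<^sub>R column 6 M) + M$2$1 *\<^sub>R column 2 M"
      by (simp add: matrix_vector_mult_6 column_nth)
    then show ?thesis
      by (simp only: isolate add.assoc)
  qed
  have "graph66 M = M \<longleftrightarrow>
      M$1$4 = 0 \<and> M$2$4 = 0 \<and> column 5 M = M$4$4 *\<^sub>R axis 5 1 + M$3$4 *\<^sub>R axis 6 1 \<and>
      M$3$4 *\<^sub>R column 6 M = - (axis 5 1 + M$4$4 *\<^sub>R column 5 M) \<and>
      M$3$4 *\<^sub>R column 3 M =
        - (axis 4 1 + M$4$4 *\<^sub>R column 4 M + M$5$4 *\<^sub>R column 5 M + M$6$4 *\<^sub>R column 6 M) \<and>
      M$2$1 *\<^sub>R column 2 M =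
        - (axis 1 1 + M$1$1 *\<^sub>R column 1 M + M$3$1 *\<^sub>R column 3 M + M$4$1 *\<^sub>R column 4 M
          + M$5$1 *\<^sub>R column 5 M + M$6$1 *\<^sub>R column 6 M)"
    unfolding graph66_def Let_def cols c4[symmetric] c5[symmetric]
      solve[OF nz(1), symmetric] solve[OF nz(2), symmetric] conj_assoc[symmetric]
    by (intro iffI; elim conjE; intro conjI; simp only:)
  then show ?thesis
    using M5 M4 M1 by blast
qed

lemma complex_structure_graph66:
  assumes "M \<in> X66"
  shows "M \<in> domain66" "graph66 M = M"
proof -
  have cs: "complex_structure G66 ((*v) M)"
    using assms by (simp add: complex_structures_def)
  note shape = complex_structure_shape[OF cs, unfolded matrix_vector_mult_basis]
  show dom: "M \<in> domain66"
    using shape by (simp add: domain66_def column_def)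
  have "M *v column j M = - axis j 1" for j
    using cs by (simp add: complex_structure_def flip: matrix_vector_mult_basis)
  then show "graph66 M = M"
    using shape(1-3) unfolding graph66_eq_iff[OF dom] column_nth by blast
qed

text \<open>The equations behind \<open>graph66\<close> already yield an automorphism carrying
  \<open>J66\<close> to \<open>M\<close>; integrability of \<open>M\<close> is then inherited from
  \<open>J66\<close> instead of being computed.\<close>

lemma graph66_imp_aut_orbit:
  assumes "M \<in> domain66" "graph66 M = M"
  shows "M \<in> aut_orbit G66 J66"
proof -
  \<comment> \<open>The powers of \<open>t\<close> in \<open>P\<close> come from brackets:
    [x_1, J x_1] = t x_4 and [J x_1, t x_4] = t^2 x_5.\<close>
  define t b d where "t = M$2$1" and "b = M$3$4" and "d = M$4$4"
  have nz: "t \<noteq> 0" "b \<noteq> 0"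
    using assms(1) by (auto simp: domain66_def t_def b_def)
  \<comment> \<open>\<open>P\<close> sends \<open>x\<^sub>1, x\<^sub>2\<close> to \<open>x\<^sub>1, J x\<^sub>1\<close>; being an automorphism intertwining \<open>J66\<close> with \<open>J = M\<close>
    then forces the other columns.\<close>
  define P :: "real^6^6" where "P = transpose (vector [axis 1 1, column 1 M, - t *\<^sub>R column 4 M,
    t *\<^sub>R axis 4 1, t\<^sup>2 *\<^sub>R axis 5 1, - t\<^sup>2 *\<^sub>R column 5 M])"
  have eqs: "M$1$4 = 0" "M$2$4 = 0" "column 5 M = d *\<^sub>R axis 5 1 + b *\<^sub>R axis 6 1"
    "M *v column 5 M = - axis 5 1" "M *v column 4 M = - axis 4 1" "M *v column 1 M = - axis 1 1"
    using assms(2) unfolding graph66_eq_iff[OF assms(1)] b_def d_def by blast+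
  have Pcol: "P *v axis 1 1 = axis 1 1" "P *v axis 2 1 = column 1 M"
    "P *v axis 3 1 = - t *\<^sub>R column 4 M" "P *v axis 4 1 = t *\<^sub>R axis 4 1"
    "P *v axis 5 1 = t\<^sup>2 *\<^sub>R axis 5 1" "P *v axis 6 1 = - t\<^sup>2 *\<^sub>R column 5 M"
    by (simp_all only: matrix_vector_mult_basis)
       (simp_all add: P_def vec_eq_iff column_def transpose_def)
  have neg: "A *v (- X) = - (A *v X)" for A :: "real^6^6" and X
    by (simp add: linear_neg[OF matrix_vector_mul_linear])
  have "(P ** J66) *v axis j 1 = (M ** P) *v axis j 1" for j
    using exhaust_6[of j]
    by (auto simp: matrix_vector_mul_assoc[symmetric] Pcol J66_basis eqs(4-6) neg
        matrix_vector_mult_scaleR matrix_vector_mult_basis[of M]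
        simp del: matrix_vector_mult_basis)
  then have comm: "P ** J66 = M ** P"
    by (rule matrix_eqI_columns)
  have PX: "P *v X = X$1 *\<^sub>R axis 1 1 + X$2 *\<^sub>R column 1 M + X$3 *\<^sub>R (- t *\<^sub>R column 4 M)
    + X$4 *\<^sub>R (t *\<^sub>R axis 4 1) + X$5 *\<^sub>R (t\<^sup>2 *\<^sub>R axis 5 1)
    + X$6 *\<^sub>R (- t\<^sup>2 *\<^sub>R column 5 M)" for X
    using matrix_vector_mult_6[of P X] by (simp only: Pcol matrix_vector_mult_basis[of P, symmetric])
  have Pn: "(P *v X) $ 1 = X$1 + X$2 * M$1$1" "(P *v X) $ 2 = X$2 * t"
    "(P *v X) $ 3 = X$2 * M$3$1 - X$3 * (t * b)"
    "(P *v X) $ 4 = X$2 * M$4$1 - X$3 * (t * d) + X$4 * t"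
    "(P *v X) $ 5 = X$2 * M$5$1 - X$3 * (t * M$5$4) + X$5 * t\<^sup>2 - X$6 * (t\<^sup>2 * d)"
    "(P *v X) $ 6 = X$2 * M$6$1 - X$3 * (t * M$6$4) - X$6 * (t\<^sup>2 * b)" for X
    using eqs(1,2) unfolding PX eqs(3)
    by (simp_all add: column_nth axis_def t_def b_def d_def)
  \<comment> \<open>In the coordinate order 2, 1, 3, 4, 6, 5 the system is triangular with diagonal
    entries t, 1, - t b, t, - t^2 b, t^2.\<close>
  have "inj ((*v) P)"
  proof (subst linear_injective_0[OF matrix_vector_mul_linear], intro allI impI)
    fix X assume "P *v X = 0"
    then have *: "(P *v X) $ i = 0" for i
      by simp
    have "X$2 = 0"
      using *[of 2] nz by (simp add: Pn)
    moreover from this have "X$1 = 0" "X$3 = 0"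
      using *[of 1] *[of 3] nz by (simp_all add: Pn)
    moreover from calculation have "X$4 = 0" "X$6 = 0"
      using *[of 4] *[of 6] nz by (simp_all add: Pn)
    moreover from calculation have "X$5 = 0"
      using *[of 5] nz by (simp add: Pn)
    ultimately show "X = 0"
      by (simp add: vec_eq_iff forall_6)
  qed
  then have "bij ((*v) P)"
    by (simp add: bij_def linear_injective_imp_surjective)
  moreover have "P *v G66 X Y = G66 (P *v X) (P *v Y)" for X Y
    by (simp add: vec_eq_iff forall_6 Pn) (simp add: algebra_simps power2_eq_square)
  ultimately have "P \<in> lie_aut G66"
    by (simp add: lie_aut_def lie_automorphism_def)
  then show ?thesis
    using comm by (intro aut_orbit_sym[OF aut_orbitI])
qed

text \<open>The implications close a cycle: complex structure, fixed point of
  \<open>graph66\<close>, orbit of \<open>J66\<close>, complex structure.\<close>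

lemma X66_eq_graph: "X66 = {M \<in> domain66. graph66 M = M}"
  using complex_structure_graph66 graph66_imp_aut_orbit
    complex_structures_aut_orbit[OF J66_complex_structure] by blast

lemma X66_eq_aut_orbit: "X66 = aut_orbit G66 J66"
  using complex_structure_graph66 graph66_imp_aut_orbit
    complex_structures_aut_orbit[OF J66_complex_structure] by blast

lemma smooth_submanifold_X66: "smooth_submanifold 10 X66"
proof -
  \<comment> \<open>The free entries: all six of column 1 and the last four of column 4, whose first
    two are 0 on the graph.\<close>
  define I :: "(6 \<times> 6) set" where "I = UNIV \<times> {1} \<union> {3, 4, 5, 6} \<times> {4}"
  define E :: "6 \<times> 6 \<Rightarrow> real^6^6" where "E = (\<lambda>(i, j). axis i (axis j 1))"
  have E: "M \<bullet> E (i, j) = M$i$j" for M i j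
    by (simp add: E_def inner_axis)
  have "inj E"
    by (auto simp: inj_def E_def axis_eq_axis)
  have "card I = 10"
    unfolding I_def by (subst card_Un_disjoint) (auto simp: card_cartesian_product)
  then have "card (E ` I) = 10"
    using \<open>inj E\<close> by (simp add: card_image inj_on_subset)
  have Basis: "(Basis :: (real^6^6) set) = range E"
    by (auto simp: E_def Basis_vec_def image_iff)
  have "smooth_submanifold (card (E ` I)) {M \<in> domain66. graph66 M = M}"
  proof (rule smooth_submanifold_graph)
    show "open domain66"
      unfolding domain66_def by (intro open_Collect_conj open_Collect_neq continuous_intros)
    show "E ` I \<subseteq> Basis"
      by (auto simp: Basis)
    have entry: "rational_on domain66 (\<lambda>M. M$i$j)" for i j
      by (rule rational_on.linear) (simp add: linear_iff)
    have "rational_on domain66 (\<lambda>M. graph66 M $ i $ j)" for i j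
    proof -
      \<comment> \<open>These functions mirror the columns bound in \<open>graph66\<close>;
        rationality is proved in their order of dependence, the only divisors being
        \<open>M$3$4\<close> and \<open>M$2$1\<close>.\<close>
      define c4 :: "real^6^6 \<Rightarrow> real^6" where "c4 M = vector [0, 0, M$3$4, M$4$4, M$5$4, M$6$4]" for M
      define c5 :: "real^6^6 \<Rightarrow> real^6" where "c5 M = vector [0, 0, 0, 0, M$4$4, M$3$4]" for M
      define c6 where "c6 M = (- 1 / M$3$4) *\<^sub>R (axis 5 1 + M$4$4 *\<^sub>R c5 M)" for M
      define c3 where "c3 M =
        (- 1 / M$3$4) *\<^sub>R (axis 4 1 + M$4$4 *\<^sub>R c4 M + M$5$4 *\<^sub>R c5 M + M$6$4 *\<^sub>R c6 M)" for M
      define c2 where "c2 M = (- 1 / M$2$1) *\<^sub>R (axis 1 1 + M$1$1 *\<^sub>R column 1 M + M$3$1 *\<^sub>R c3 M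
        + M$4$1 *\<^sub>R c4 M + M$5$1 *\<^sub>R c5 M + M$6$1 *\<^sub>R c6 M)" for M
      note rat = rational_on.const entry rational_on.add rational_on.mult rational_on_divide
      note expand = vector_scaleR_component vector_add_component real_scaleR_def column_nth
      have nz: "M$2$1 \<noteq> 0" "M$3$4 \<noteq> 0" if "M \<in> domain66" for M
        using that by (auto simp: domain66_def)
      have r4: "rational_on domain66 (\<lambda>M. c4 M $ k)" for k
        using exhaust_6[of k] by (auto simp: c4_def rational_on.const entry)
      have r5: "rational_on domain66 (\<lambda>M. c5 M $ k)" for k
        using exhaust_6[of k] by (auto simp: c5_def rational_on.const entry)
      have r6: "rational_on domain66 (\<lambda>M. c6 M $ k)" for k
        unfolding c6_def expand by (intro rat r5 nz)
      have r3: "rational_on domain66 (\<lambda>M. c3 M $ k)" for k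
        unfolding c3_def expand by (intro rat r4 r5 r6 nz)
      have r2: "rational_on domain66 (\<lambda>M. c2 M $ k)" for k
        unfolding c2_def expand by (intro rat r3 r4 r5 r6 nz)
      have "graph66 M $ i $ j = vector [column 1 M, c2 M, c3 M, c4 M, c5 M, c6 M] $ j $ i" for M
        by (simp add: graph66_def Let_def transpose_def c2_def c3_def c4_def c5_def c6_def)
      then show ?thesis
        using exhaust_6[of j] by (auto simp: column_nth entry r2 r3 r4 r5 r6)
    qed
    then show "rational_on domain66 (\<lambda>M. graph66 M \<bullet> B)" if "B \<in> Basis" for B
      using that by (auto simp: Basis E)
    fix M assume M: "M \<in> domain66"
    show "graph66 M \<bullet> B = M \<bullet> B" if "B \<in> E ` I" for B
      using that
      by (auto simp: I_def E graph66_def Let_def transpose_def column_def)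
    \<comment> \<open>Both \<open>domain66\<close> and \<open>graph66\<close> read only entries
      indexed by \<open>I\<close>.\<close>
    fix N assume "\<And>B. B \<in> E ` I \<Longrightarrow> N \<bullet> B = M \<bullet> B"
    then have *: "N$i$j = M$i$j" if "(i, j) \<in> I" for i j
      using that E by (metis imageI)
    have "N$i$1 = M$i$1" for i
      by (rule *) (simp add: I_def)
    moreover have "N$3$4 = M$3$4" "N$4$4 = M$4$4" "N$5$4 = M$5$4" "N$6$4 = M$6$4"
      by (rule *; simp add: I_def)+
    ultimately show "N \<in> domain66 \<and> graph66 N = graph66 M"
      using M by (simp add: domain66_def graph66_def column_def)
  qed
  then show ?thesis
    by (simp add: X66_eq_graph \<open>card (E ` I) = 10\<close>)
qed

theorem mainTheorem5:
  shows "smooth_submanifold 10 X66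
    \<and> J66 \<in> X66 \<and> X66 = aut_orbit G66 J66
    \<and> (\<forall>J\<in>X66. cs_equivalent G66 J J66)"
  unfolding cs_equivalent_def
proof (intro conjI ballI smooth_submanifold_X66 J66_complex_structure X66_eq_aut_orbit aut_orbit_eq)
  show "J \<in> aut_orbit G66 J66" if "J \<in> X66" for J
    using that by (simp only: X66_eq_aut_orbit)
qed

end
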